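(* Let $p,\hat k\in\mathbb Z^2\setminus\{0\}$ and $\Gamma\in\mathbb C$. If $\Sigma_{\hat k}\cap\bar D_{|p|}=\emptyset$, then the linear system $$\dot\omega_{\hat k+np}=A(p,\hat k+(n-1)p)\,\Gamma\,\omega_{\hat k+(n-1)p}+A(-p,\hat k+(n+1)p)\,\bar\Gamma\,\omega_{\hat k+(n+1)p},\qquad n\in\mathbb Z,$$ is Liapunov stable for all $t\in\mathbb R$; in fact every solution satisfies $$\sum_{n\in\mathbb Z}|\omega_{\hat k+np}(t)|^2\le\sigma\sum_{n\in\mathbb Z}|\omega_{\hat k+np}(0)|^2,\qquad\forall t\in\mathbb R,$$ where $$\sigma=\Big[\sup_{n\in\mathbb Z}\{-\rho_n\}\Big]\Big[\min_{n\in\mathbb Z}\{-\rho_n\}\Big]^{-1},\qquad 0<\sigma<\infty.$$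
   Context: For $p,q\in\mathbb Z^2\setminus\{0\}$ set $A(p,q)=\frac12\,[\,|q|^{-2}-|p|^{-2}\,]\,(p_1q_2-p_2q_1)$, where $|q|^2=q_1^2+q_2^2$. Put $\rho_n=|\hat k+np|^{-2}-|p|^{-2}$. The class of $\hat k$ is $\Sigma_{\hat k}=\{\hat k+np\in\mathbb Z^2\setminus\{0\}: n\in\mathbb Z\}$. The closed disk is $\bar D_{|p|}=\{k\in\mathbb Z^2\setminus\{0\}: |k|\le|p|\}$. (The system is an invariant subsystem of the 2D Euler equation on the torus in Fourier-vorticity variables, linearized at the steady state with $\omega_p=\Gamma$, $\omega_{-p}=\bar\Gamma$ and all other modes zero.) The unknowns $\omega_{\hat k+np}$ are complex, and solutions are curves $t\mapsto(\omega_{\hat k+np}(t))_{n\in\mathbb Z}$ in $\ell_2(\mathbb Z;\mathbb C)$, differentiable in $t$, satisfying the system. Liapunov stable means that the zero solution is stable in the $\ell_2$ norm. *)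

theory Defs
  imports "HOL-Analysis.Analysis"
begin

type_synonym mode = "int \<times> int"

definition mode_norm :: "mode \<Rightarrow> real" where
  "mode_norm q = norm (real_of_int (fst q), real_of_int (snd q))"

definition A :: "mode \<Rightarrow> mode \<Rightarrow> real" where
  "A p q = 1 / 2 * (inverse ((mode_norm q)\<^sup>2) - inverse ((mode_norm p)\<^sup>2))
             * real_of_int (fst p * snd q - snd p * fst q)"

text \<open>The lattice point \<open>k + n p\<close>.\<close>
definition shift :: "mode \<Rightarrow> mode \<Rightarrow> int \<Rightarrow> mode" where
  "shift k p n = (fst k + n * fst p, snd k + n * snd p)"

definition mode_class :: "mode \<Rightarrow> mode \<Rightarrow> mode set" where
  "mode_class k p = range (shift k p) - {0}"

definition closed_disk :: "mode \<Rightarrow> mode set" where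
  "closed_disk p = {k. k \<noteq> 0 \<and> mode_norm k \<le> mode_norm p}"

definition rho :: "mode \<Rightarrow> mode \<Rightarrow> int \<Rightarrow> real" where
  "rho p k n = inverse ((mode_norm (shift k p n))\<^sup>2) - inverse ((mode_norm p)\<^sup>2)"

text \<open>\<open>INF\<close> stands for the minimum in the denominator. Since \<open>SUP\<close>, \<open>INF\<close> and \<open>inverse\<close>
  are total on the reals, this is the intended finite quantity only when \<open>- rho p k\<close> is
  bounded above and attains a nonzero minimum.\<close>
definition energy_ratio :: "mode \<Rightarrow> mode \<Rightarrow> real" where
  "energy_ratio p k = (SUP n. - rho p k n) * inverse (INF n. - rho p k n)"

definition l2 :: "(int \<Rightarrow> complex) set" where
  "l2 = {u. (\<lambda>n. (cmod (u n))\<^sup>2) summable_on UNIV}"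

definition l2_norm :: "(int \<Rightarrow> complex) \<Rightarrow> real" where
  "l2_norm u = sqrt (\<Sum>\<^sub>\<infinity>n. (cmod (u n))\<^sup>2)"

text \<open>Differentiability of a curve in the norm of \<open>l2\<close>. The membership conditions are needed
  because \<open>l2_norm\<close> is \<open>0\<close> on sequences that are not square summable.\<close>
definition l2_has_derivative ::
  "(real \<Rightarrow> int \<Rightarrow> complex) \<Rightarrow> (int \<Rightarrow> complex) \<Rightarrow> real \<Rightarrow> bool" where
  "l2_has_derivative w v t \<longleftrightarrow>
     (\<forall>s. w s \<in> l2) \<and> v \<in> l2 \<and>
     ((\<lambda>h. l2_norm (\<lambda>n. (w (t + h) n - w t n) / of_real h - v n)) \<longlongrightarrow> 0) (at 0)"

text \<open>The component \<open>u n\<close> is the Fourier mode of vorticity at \<open>k + n p\<close>.\<close>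
definition euler_rhs ::
  "mode \<Rightarrow> mode \<Rightarrow> complex \<Rightarrow> (int \<Rightarrow> complex) \<Rightarrow> int \<Rightarrow> complex" where
  "euler_rhs p k \<Gamma> u n =
     of_real (A p (shift k p (n - 1))) * \<Gamma> * u (n - 1)
     + of_real (A (- p) (shift k p (n + 1))) * cnj \<Gamma> * u (n + 1)"

definition is_solution ::
  "mode \<Rightarrow> mode \<Rightarrow> complex \<Rightarrow> (real \<Rightarrow> int \<Rightarrow> complex) \<Rightarrow> bool" where
  "is_solution p k \<Gamma> w \<longleftrightarrow> (\<forall>t. l2_has_derivative w (euler_rhs p k \<Gamma> (w t)) t)"

text \<open>Stability of the zero solution of the autonomous system with solution set \<open>S\<close>, for all
  forward and backward times.\<close>
definition liapunov_stable :: "(real \<Rightarrow> int \<Rightarrow> complex) set \<Rightarrow> bool" where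
  "liapunov_stable S \<longleftrightarrow>
     (\<forall>\<epsilon>>0. \<exists>\<delta>>0. \<forall>w\<in>S. l2_norm (w 0) < \<delta> \<longrightarrow> (\<forall>t. l2_norm (w t) < \<epsilon>))"

end

theory Submission
  imports Defs
begin

text \<open>The quadratic form \<open>E(t) = \<Sum>n. - \<rho> n * |w t n|\<^sup>2\<close> is conserved by the system for every \<open>p\<close> and
  \<open>k\<close>. When the class avoids the closed disk, \<open>|p| < |k + n p|\<close> for all \<open>n\<close>, so the weights
  \<open>- \<rho> n\<close> are positive and at most \<open>|p|\<^sup>-\<^sup>2\<close>, and their minimum is attained because the \<open>|k + n p|\<^sup>2\<close>
  are integers. Hence \<open>E\<close> is equivalent to the squared \<open>l2\<close> norm, with the constants in \<open>\<sigma>\<close>.\<close>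

section \<open>Square summable sequences: Cauchy-Schwarz and closure properties\<close>

lemma l2_mult:
  assumes "u \<in> l2" "v \<in> l2"
  shows l2_mult_summable: "(\<lambda>n. cmod (u n) * cmod (v n)) summable_on UNIV"
    and l2_mult_infsum_le: "(\<Sum>\<^sub>\<infinity>n. cmod (u n) * cmod (v n)) \<le> l2_norm u * l2_norm v"
proof -
  have le: "L2_set (\<lambda>n. cmod (w n)) F \<le> l2_norm w" if "w \<in> l2" "finite F" for w F
    unfolding L2_set_def l2_norm_def
    using that by (intro real_sqrt_le_mono finite_sum_le_infsum) (auto simp: l2_def)
  \<comment> \<open>Cauchy-Schwarz on finite index sets, with a bound independent of
    \<open>F\<close>. This one estimate yields both the summability and the bound on the infinite
    sum.\<close>
  have bound: "(\<Sum>n\<in>F. cmod (u n) * cmod (v n)) \<le> l2_norm u * l2_norm v" if "finite F" for F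
  proof -
    have "(\<Sum>n\<in>F. cmod (u n) * cmod (v n)) \<le> L2_set (\<lambda>n. cmod (u n)) F * L2_set (\<lambda>n. cmod (v n)) F"
      using L2_set_mult_ineq[of "\<lambda>n. cmod (u n)" "\<lambda>n. cmod (v n)" F] by simp
    also have "\<dots> \<le> l2_norm u * l2_norm v"
      using that assms by (intro mult_mono le) (auto simp: l2_norm_def infsum_nonneg L2_set_nonneg)
    finally show ?thesis .
  qed
  show s: "(\<lambda>n. cmod (u n) * cmod (v n)) summable_on UNIV"
    using bound by (intro nonneg_bdd_above_summable_on bdd_aboveI2) auto
  show "(\<Sum>\<^sub>\<infinity>n. cmod (u n) * cmod (v n)) \<le> l2_norm u * l2_norm v"
    using bound s by (intro infsum_le_finite_sums) auto
qed

lemma l2_add: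
  assumes "u \<in> l2" "v \<in> l2"
  shows "(\<lambda>n. u n + v n) \<in> l2"
proof -
  have *: "(\<lambda>n. 2 * (cmod (u n))\<^sup>2 + 2 * (cmod (v n))\<^sup>2) summable_on UNIV"
    using assms by (intro summable_on_add summable_on_cmult_right) (auto simp: l2_def)
  have "(cmod (u n + v n))\<^sup>2 \<le> 2 * (cmod (u n))\<^sup>2 + 2 * (cmod (v n))\<^sup>2" for n
  proof -
    have "(cmod (u n + v n))\<^sup>2 \<le> (cmod (u n) + cmod (v n))\<^sup>2"
      by (intro power_mono norm_triangle_ineq) auto
    also have "\<dots> \<le> 2 * (cmod (u n))\<^sup>2 + 2 * (cmod (v n))\<^sup>2"
      using sum_squares_bound[of "cmod (u n)" "cmod (v n)"] by (simp add: power2_sum)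
    finally show ?thesis .
  qed
  then show ?thesis
    unfolding l2_def by (auto intro!: summable_on_comparison_test[OF *])
qed

lemma l2_bounded_mult:
  fixes c :: "int \<Rightarrow> complex"
  assumes "u \<in> l2" "\<And>n. cmod (c n) \<le> M"
  shows "(\<lambda>n. c n * u n) \<in> l2"
proof -
  have *: "(\<lambda>n. M\<^sup>2 * (cmod (u n))\<^sup>2) summable_on UNIV"
    using assms by (intro summable_on_cmult_right) (auto simp: l2_def)
  show ?thesis
    unfolding l2_def using assms(2)
    by (auto intro!: summable_on_comparison_test[OF *] mult_right_mono power_mono
        simp: norm_mult power_mult_distrib)
qed

lemma l2_shift:
  assumes "u \<in> l2"
  shows "(\<lambda>n. u (n + m)) \<in> l2"
proof -
  have "bij_betw (\<lambda>n::int. n + m) UNIV UNIV"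
    by (rule bij_betwI[of _ _ _ "\<lambda>n. n - m"]) auto
  from summable_on_reindex_bij_betw[OF this, of "\<lambda>n. (cmod (u n))\<^sup>2"] assms show ?thesis
    by (simp add: l2_def)
qed

section \<open>Weighted quadratic forms on \<open>l2\<close> and their derivatives\<close>

text \<open>Here \<open>\<bullet>\<close> on complex numbers is the real inner product, the real
  part of \<open>cnj x * y\<close>. The form is therefore real valued and symmetric, so the energy
  can be differentiated as a real function of time.\<close>

definition weighted_inner :: "(int \<Rightarrow> real) \<Rightarrow> (int \<Rightarrow> complex) \<Rightarrow> (int \<Rightarrow> complex) \<Rightarrow> real" where
  "weighted_inner a u v = (\<Sum>\<^sub>\<infinity>n. a n * (u n \<bullet> v n))"

lemma weighted_inner:
  assumes "u \<in> l2" "v \<in> l2" "\<And>n. \<bar>a n\<bar> \<le> M"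
  shows weighted_inner_summable: "(\<lambda>n. a n * (u n \<bullet> v n)) summable_on UNIV"
    and abs_weighted_inner_le: "\<bar>weighted_inner a u v\<bar> \<le> M * (l2_norm u * l2_norm v)"
proof -
  have M: "0 \<le> M"
    using assms(3)[of 0] by simp
  have s: "(\<lambda>n. M * (cmod (u n) * cmod (v n))) summable_on UNIV"
    by (intro summable_on_cmult_right l2_mult_summable assms)
  have le: "norm (a n * (u n \<bullet> v n)) \<le> M * (cmod (u n) * cmod (v n))" for n
    using assms(3)[of n] M by (auto simp: abs_mult intro!: mult_mono Cauchy_Schwarz_ineq2)
  have abs: "(\<lambda>n. norm (a n * (u n \<bullet> v n))) summable_on UNIV"
    using le by (intro summable_on_comparison_test[OF s]) auto
  then show "(\<lambda>n. a n * (u n \<bullet> v n)) summable_on UNIV"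
    by (rule abs_summable_summable)
  have "\<bar>weighted_inner a u v\<bar> \<le> (\<Sum>\<^sub>\<infinity>n. norm (a n * (u n \<bullet> v n)))"
    using norm_infsum_bound[OF abs] by (simp add: weighted_inner_def)
  also have "\<dots> \<le> (\<Sum>\<^sub>\<infinity>n. M * (cmod (u n) * cmod (v n)))"
    using le by (intro infsum_mono abs s) auto
  also have "\<dots> = M * (\<Sum>\<^sub>\<infinity>n. cmod (u n) * cmod (v n))"
    by (rule infsum_cmult_right')
  also have "\<dots> \<le> M * (l2_norm u * l2_norm v)"
    by (intro mult_left_mono l2_mult_infsum_le assms M)
  finally show "\<bar>weighted_inner a u v\<bar> \<le> M * (l2_norm u * l2_norm v)" .
qed

lemma weighted_inner_add_right:
  assumes "u \<in> l2" "v \<in> l2" "v' \<in> l2" "\<And>n. \<bar>a n\<bar> \<le> M"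
  shows "weighted_inner a u (\<lambda>n. v n + v' n) = weighted_inner a u v + weighted_inner a u v'"
  unfolding weighted_inner_def
  using infsum_add[OF weighted_inner_summable[OF assms(1,2,4)] weighted_inner_summable[OF assms(1,3,4)]]
  by (simp add: inner_add_right distrib_left)

lemma weighted_inner_commute: "weighted_inner a u v = weighted_inner a v u"
  by (simp add: weighted_inner_def inner_commute)

lemma weighted_inner_scale_right:
  "weighted_inner a u (\<lambda>n. of_real r * v n) = r * weighted_inner a u v"
proof -
  have "a n * (u n \<bullet> (of_real r * v n)) = r * (a n * (u n \<bullet> v n))" for n
    by (simp add: scaleR_conv_of_real[symmetric])
  then show ?thesis
    unfolding weighted_inner_def by (simp only: infsum_cmult_right')
qed

text \<open>Binomial expansion of a symmetric real bilinear form. It serves twice in the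
  differentiation below: with \<open>r = h\<close> for the increment of the curve and with
  \<open>r = 1\<close> for the error in its difference quotient.\<close>

lemma weighted_inner_square_add_scale:
  assumes u: "u \<in> l2" and v: "v \<in> l2" and a: "\<And>n. \<bar>a n\<bar> \<le> M"
  shows "weighted_inner a (\<lambda>n. u n + of_real r * v n) (\<lambda>n. u n + of_real r * v n)
    = weighted_inner a u u + 2 * r * weighted_inner a u v + r\<^sup>2 * weighted_inner a v v"
proof -
  let ?rv = "\<lambda>n. of_real r * v n"
  have rv: "?rv \<in> l2"
    by (rule l2_bounded_mult[OF v, of _ "\<bar>r\<bar>"]) simp
  have "weighted_inner a (\<lambda>n. u n + ?rv n) (\<lambda>n. u n + ?rv n)
    = weighted_inner a (\<lambda>n. u n + ?rv n) u + weighted_inner a (\<lambda>n. u n + ?rv n) ?rv"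
    by (intro weighted_inner_add_right[OF _ _ _ a] l2_add u rv)
  also have "weighted_inner a (\<lambda>n. u n + ?rv n) u = weighted_inner a u u + weighted_inner a u ?rv"
    by (subst weighted_inner_commute) (intro weighted_inner_add_right[OF _ _ _ a] u rv)
  also have "weighted_inner a (\<lambda>n. u n + ?rv n) ?rv = weighted_inner a ?rv u + weighted_inner a ?rv ?rv"
    by (subst weighted_inner_commute) (intro weighted_inner_add_right[OF _ _ _ a] u rv)
  also have "weighted_inner a ?rv ?rv = r\<^sup>2 * weighted_inner a v v"
    by (simp add: weighted_inner_scale_right weighted_inner_commute[of a ?rv] power2_eq_square)
  finally show ?thesis
    by (simp add: weighted_inner_scale_right weighted_inner_commute[of a ?rv])
qed

text \<open>Differentiating term by term would need an interchange of limit and infinite sum.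
  Instead, \<open>w (t + h) = w t + h (v + e h)\<close> with \<open>e h\<close> tending to 0 in
  \<open>l2\<close>; the form is expanded exactly, and continuity of the form in the
  \<open>l2\<close> norm disposes of every term that contains \<open>e h\<close>.\<close>

lemma weighted_inner_has_derivative:
  assumes d: "l2_has_derivative w v t" and a: "\<And>n. \<bar>a n\<bar> \<le> M"
  shows "((\<lambda>s. weighted_inner a (w s) (w s)) has_real_derivative 2 * weighted_inner a (w t) v) (at t)"
proof -
  define e where "e h = (\<lambda>n. (w (t + h) n - w t n) / of_real h - v n)" for h
  have w: "w s \<in> l2" for s
    using d by (simp add: l2_has_derivative_def)
  have v: "v \<in> l2" and lim: "((\<lambda>h. l2_norm (e h)) \<longlongrightarrow> 0) (at 0)"
    using d by (auto simp: l2_has_derivative_def e_def)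
  have uminus: "(\<lambda>n. - u n) \<in> l2" if "u \<in> l2" for u
    using l2_bounded_mult[OF that, of "\<lambda>_. - 1" 1] by simp
  \<comment> \<open>No case distinction is made: at \<open>h = 0\<close> division gives 0, so
    \<open>e 0\<close> is \<open>- v\<close>, still in \<open>l2\<close>.\<close>
  have e: "e h \<in> l2" for h
  proof -
    have "(\<lambda>n. (1 / of_real h) * (w (t + h) n + - w t n)) \<in> l2"
      by (rule l2_bounded_mult[OF l2_add[OF w uminus[OF w]], of _ "cmod (1 / of_real h)"]) simp
    from l2_add[OF this uminus[OF v]] show ?thesis
      by (simp add: e_def)
  qed
  define B where "B = weighted_inner a"
  \<comment> \<open>\<open>R h\<close> is what remains of the difference quotient of the form once
    its expected limit \<open>2 * B (w t) v\<close> is removed.\<close>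
  define R where "R h = 2 * B (w t) (e h) + h * (B v v + 2 * B v (e h) + B (e h) (e h))" for h
  have quot: "(B (w (t + h)) (w (t + h)) - B (w t) (w t)) / h = 2 * B (w t) v + R h" if "h \<noteq> 0" for h
  proof -
    have 1: "w (t + h) = (\<lambda>n. w t n + of_real h * (v n + of_real 1 * e h n))"
      using that by (auto simp: e_def)
    have "B (w (t + h)) (w (t + h))
      = B (w t) (w t) + 2 * h * B (w t) (\<lambda>n. v n + of_real 1 * e h n)
        + h\<^sup>2 * B (\<lambda>n. v n + of_real 1 * e h n) (\<lambda>n. v n + of_real 1 * e h n)"
      unfolding 1 B_def
      by (rule weighted_inner_square_add_scale[OF w _ a]) (use l2_add[OF v e] in simp)
    also have "B (\<lambda>n. v n + of_real 1 * e h n) (\<lambda>n. v n + of_real 1 * e h n)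
      = B v v + 2 * 1 * B v (e h) + 1\<^sup>2 * B (e h) (e h)"
      unfolding B_def by (rule weighted_inner_square_add_scale[OF v e a])
    also have "B (w t) (\<lambda>n. v n + of_real 1 * e h n) = B (w t) v + B (w t) (e h)"
      unfolding B_def using weighted_inner_add_right[OF w v e a] by simp
    finally show ?thesis
      using that by (simp add: R_def field_simps power2_eq_square)
  qed
  have Be: "((\<lambda>h. B u (e h)) \<longlongrightarrow> 0) (at 0)" if "u \<in> l2" for u
  proof (rule Lim_null_comparison)
    show "\<forall>\<^sub>F h in at 0. norm (B u (e h)) \<le> M * (l2_norm u * l2_norm (e h))"
      using abs_weighted_inner_le[OF that e a] by (simp add: B_def)
    show "((\<lambda>h. M * (l2_norm u * l2_norm (e h))) \<longlongrightarrow> 0) (at 0)"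
      by (intro tendsto_mult_right_zero lim)
  qed
  have Bee: "((\<lambda>h. B (e h) (e h)) \<longlongrightarrow> 0) (at 0)"
  proof (rule Lim_null_comparison)
    show "\<forall>\<^sub>F h in at 0. norm (B (e h) (e h)) \<le> M * (l2_norm (e h) * l2_norm (e h))"
      using abs_weighted_inner_le[OF e e a] by (simp add: B_def)
    show "((\<lambda>h. M * (l2_norm (e h) * l2_norm (e h))) \<longlongrightarrow> 0) (at 0)"
      by (intro tendsto_mult_right_zero tendsto_mult_zero lim)
  qed
  have "(R \<longlongrightarrow> 2 * 0 + 0 * (B v v + 2 * 0 + 0)) (at 0)"
    unfolding R_def by (intro tendsto_intros Be Bee w v)
  then have "((\<lambda>h. 2 * B (w t) v + R h) \<longlongrightarrow> 2 * B (w t) v + 0) (at 0)"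
    by (intro tendsto_add tendsto_const) simp
  moreover have "\<forall>\<^sub>F h in at 0. 2 * B (w t) v + R h
      = (B (w (t + h)) (w (t + h)) - B (w t) (w t)) / h"
    using quot by (auto simp: eventually_at_filter)
  ultimately have "((\<lambda>h. (B (w (t + h)) (w (t + h)) - B (w t) (w t)) / h) \<longlongrightarrow> 2 * B (w t) v) (at 0)"
    using Lim_transform_eventually by fastforce
  then show ?thesis
    by (simp add: DERIV_def B_def)
qed

section \<open>Coefficients of the system and the energy identity\<close>

lemma mode_norm_sq: "(mode_norm q)\<^sup>2 = real_of_int ((fst q)\<^sup>2 + (snd q)\<^sup>2)"
  by (simp add: mode_norm_def norm_Pair)

text \<open>Adding multiples of \<open>p\<close> to \<open>k\<close> leaves the determinant of
  \<open>p\<close> and \<open>k\<close> unchanged, so only the factor \<open>rho\<close> depends on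
  \<open>n\<close>.\<close>

lemma A_shift: "A p (shift k p n) = 1 / 2 * rho p k n * real_of_int (fst p * snd k - snd p * fst k)"
  by (simp add: A_def rho_def shift_def algebra_simps)

lemma A_uminus: "A (- p) q = - A p q"
proof -
  have "mode_norm (- p) = mode_norm p"
    by (simp add: mode_norm_def norm_Pair)
  moreover have "real_of_int (fst (- p) * snd q - snd (- p) * fst q) = - real_of_int (fst p * snd q - snd p * fst q)"
    by simp
  ultimately show ?thesis
    unfolding A_def by (simp only: mult_minus_right)
qed

text \<open>Each coefficient carries the \<open>rho\<close> of the very mode it multiplies, so the
  right-hand side depends on \<open>u\<close> only through the products
  \<open>rho p k n * u n\<close>. The minus sign comes from \<open>A\<close> being odd in its first
  argument.\<close>

lemma euler_rhs_rho:
  "euler_rhs p k \<Gamma> u n = of_real (real_of_int (fst p * snd k - snd p * fst k) / 2) *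
     (\<Gamma> * (of_real (rho p k (n - 1)) * u (n - 1)) - cnj \<Gamma> * (of_real (rho p k (n + 1)) * u (n + 1)))"
  unfolding euler_rhs_def A_uminus A_shift by (simp add: field_simps)

text \<open>The sum telescopes: with \<open>z n = \<rho> n u n\<close>, the two terms of the right-hand side contribute
  \<open>(\<Gamma> z (n - 1)) \<bullet> z n\<close> and \<open>(\<Gamma> z n) \<bullet> z (n + 1)\<close> with opposite signs.\<close>
lemma weighted_inner_euler_rhs:
  assumes u: "u \<in> l2" and M: "\<And>n. \<bar>rho p k n\<bar> \<le> M"
  shows "weighted_inner (\<lambda>n. - rho p k n) u (euler_rhs p k \<Gamma> u) = 0"
proof -
  define z where "z n = of_real (rho p k n) * u n" for n
  define f where "f n = (\<Gamma> * z n) \<bullet> z (n + 1)" for n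
  define c where "c = real_of_int (fst p * snd k - snd p * fst k) / 2"
  have z: "z \<in> l2"
    unfolding z_def using M by (intro l2_bounded_mult[OF u]) auto
  then have "(\<lambda>n. \<Gamma> * z n) \<in> l2"
    by (rule l2_bounded_mult[of _ _ "cmod \<Gamma>"]) simp
  from weighted_inner_summable[OF this l2_shift[OF z], of "\<lambda>_. 1" 1]
  have f: "f summable_on UNIV"
    by (simp add: f_def[abs_def])
  have bij: "bij_betw (\<lambda>n::int. n - 1) UNIV UNIV"
    by (rule bij_betwI[of _ _ _ "\<lambda>n. n + 1"]) auto
  have summand: "- rho p k n * (u n \<bullet> euler_rhs p k \<Gamma> u n) = c * f n + - c * f (n - 1)" for n
  proof -
    have "- rho p k n * (u n \<bullet> euler_rhs p k \<Gamma> u n)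
        = - (z n \<bullet> (of_real c * (\<Gamma> * z (n - 1) - cnj \<Gamma> * z (n + 1))))"
      by (simp add: z_def c_def euler_rhs_rho scaleR_conv_of_real[symmetric])
    \<comment> \<open>For the real inner product, multiplication by \<open>cnj \<Gamma>\<close> is
      adjoint to multiplication by \<open>\<Gamma>\<close>. The term with \<open>z (n + 1)\<close>
      thus becomes \<open>f n\<close>, and the one with \<open>z (n - 1)\<close> is
      \<open>f (n - 1)\<close> by symmetry.\<close>
    also have "\<dots> = c * f n + - c * f (n - 1)"
      by (simp add: f_def inner_complex_def algebra_simps)
    finally show ?thesis .
  qed
  have "weighted_inner (\<lambda>n. - rho p k n) u (euler_rhs p k \<Gamma> u) = (\<Sum>\<^sub>\<infinity>n. c * f n + - c * f (n - 1))"
    unfolding weighted_inner_def summand ..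
  \<comment> \<open>Summability of \<open>f\<close> allows the series to be split; as
    \<open>n\<close> runs over all integers, the shift then leaves no boundary term.\<close>
  also have "\<dots> = (\<Sum>\<^sub>\<infinity>n. c * f n) + (\<Sum>\<^sub>\<infinity>n. - c * f (n - 1))"
    using f summable_on_reindex_bij_betw[OF bij, of f]
    by (intro infsum_add summable_on_cmult_right) auto
  also have "\<dots> = c * (\<Sum>\<^sub>\<infinity>n. f n) + - c * (\<Sum>\<^sub>\<infinity>n. f (n - 1))"
    by (simp only: infsum_cmult_right')
  also have "(\<Sum>\<^sub>\<infinity>n. f (n - 1)) = (\<Sum>\<^sub>\<infinity>n. f n)"
    by (rule infsum_reindex_bij_betw[OF bij])
  finally show ?thesis
    by simp
qed

section \<open>Bounds on the weights\<close>

text \<open>The class omits the origin, so disjointness from the disk bounds only the nonzero points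
  of the line directly. The case of a point at the origin has to be refuted separately.\<close>

lemma mode_norm_shift_gt:
  assumes "p \<noteq> 0" and "mode_class k p \<inter> closed_disk p = {}"
  shows "mode_norm p < mode_norm (shift k p n)"
proof -
  have "shift k p n \<noteq> 0"
  proof
    assume "shift k p n = 0"
    \<comment> \<open>then the class contains \<open>p\<close> itself\<close>
    then have "shift k p (n + 1) = p"
      by (auto simp: shift_def prod_eq_iff algebra_simps)
    then have "p \<in> mode_class k p \<inter> closed_disk p"
      using assms(1) by (auto simp: mode_class_def closed_disk_def intro: range_eqI[of _ _ "n + 1"])
    then show False
      using assms(2) by simp
  qed
  then have "shift k p n \<in> mode_class k p" "shift k p n \<noteq> 0"
    by (auto simp: mode_class_def)
  then show ?thesis
    using assms(2) by (force simp: closed_disk_def)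
qed

lemma neg_rho_bounds:
  assumes "p \<noteq> 0" and "mode_class k p \<inter> closed_disk p = {}"
  shows neg_rho_pos: "0 < - rho p k n"
    and neg_rho_le: "- rho p k n \<le> inverse ((mode_norm p)\<^sup>2)"
    and neg_rho_has_min: "\<exists>m. \<forall>n. - rho p k m \<le> - rho p k n"
proof -
  have "0 < mode_norm p"
    using assms(1) by (auto simp: mode_norm_def prod_eq_iff)
  then have pos: "0 < mode_norm p" "0 < mode_norm (shift k p n)" for n
    using mode_norm_shift_gt[OF assms, of n] by auto
  show "0 < - rho p k n"
    using mode_norm_shift_gt[OF assms, of n] pos by (simp add: rho_def power_strict_mono)
  show "- rho p k n \<le> inverse ((mode_norm p)\<^sup>2)"
    by (simp add: rho_def)
  \<comment> \<open>Squared lengths are taken as natural numbers so that well-ordering supplies a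
    minimizer \<open>m\<close>, a point of the line closest to the origin. The weight increases with
    the length, so it is smallest there.\<close>
  define N where "N n = nat ((fst (shift k p n))\<^sup>2 + (snd (shift k p n))\<^sup>2)" for n
  have N: "(mode_norm (shift k p n))\<^sup>2 = real (N n)" for n
    by (simp add: N_def mode_norm_sq)
  define m where "m = arg_min N (\<lambda>_. True)"
  have "N m \<le> N n" for n
    unfolding m_def by (rule arg_min_nat_le) simp
  \<comment> \<open>Inversion reverses the order only between positive numbers;
    \<open>inverse 0\<close> is 0.\<close>
  moreover have "0 < real (N n)" for n
    unfolding N[symmetric] using pos(2)[of n] by simp
  ultimately have "- rho p k m \<le> - rho p k n" for n
    by (simp add: rho_def N)
  then show "\<exists>m. \<forall>n. - rho p k m \<le> - rho p k n"
    by blast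
qed

section \<open>Conservation of the energy, the norm estimate and stability\<close>

theorem mainTheorem1:
  fixes p k :: mode and \<Gamma> :: complex
  assumes "p \<noteq> 0" and "k \<noteq> 0"
    and "mode_class k p \<inter> closed_disk p = {}"
  shows "liapunov_stable {w. is_solution p k \<Gamma> w}
    \<and> (\<forall>w. is_solution p k \<Gamma> w \<longrightarrow>
         (\<forall>t. (\<Sum>\<^sub>\<infinity>n. (cmod (w t n))\<^sup>2) \<le> energy_ratio p k * (\<Sum>\<^sub>\<infinity>n. (cmod (w 0 n))\<^sup>2)))
    \<and> bdd_above (range (\<lambda>n. - rho p k n))
    \<and> (\<exists>m. 0 < - rho p k m \<and> (\<forall>n. - rho p k m \<le> - rho p k n))
    \<and> 0 < energy_ratio p k"
proof -
  define a where "a n = - rho p k n" for n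
  define M where "M = inverse ((mode_norm p)\<^sup>2)"
  define S where "S = (SUP n. a n)"
  have a_pos: "0 < a n" and a_le: "a n \<le> M" for n
    using neg_rho_pos[OF assms(1,3)] neg_rho_le[OF assms(1,3)] by (auto simp: a_def M_def)
  then have a_abs: "\<bar>a n\<bar> \<le> M" and rho_abs: "\<bar>rho p k n\<bar> \<le> M" for n
    using less_imp_le[OF a_pos[of n]] a_le[of n] by (auto simp: a_def)
  obtain m where m: "\<And>n. a m \<le> a n"
    using neg_rho_has_min[OF assms(1,3)] by (auto simp: a_def)
  have bdd: "bdd_above (range a)"
    using a_le by (intro bdd_aboveI2)
  have a_le_S: "a n \<le> S" for n
    unfolding S_def by (intro cSUP_upper bdd) simp
  \<comment> \<open>The infimum is attained, so it is a positive number and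
    \<open>energy_ratio\<close> is a genuine quotient.\<close>
  have "(INF n. a n) = a m"
    by (intro cInf_eq_minimum) (auto intro: m)
  then have ratio: "energy_ratio p k = S / a m"
    by (simp add: energy_ratio_def a_def[symmetric] S_def divide_inverse)
  have ratio_pos: "0 < energy_ratio p k"
    using a_pos[of m] a_le_S[of m] by (simp add: ratio)
  have estimate: "(\<Sum>\<^sub>\<infinity>n. (cmod (w t n))\<^sup>2) \<le> energy_ratio p k * (\<Sum>\<^sub>\<infinity>n. (cmod (w 0 n))\<^sup>2)"
    if sol: "is_solution p k \<Gamma> w" for w t
  proof -
    have l2: "w s \<in> l2" for s
      using sol by (auto simp: is_solution_def l2_has_derivative_def)
    have sq: "(\<lambda>n. (cmod (w s n))\<^sup>2) summable_on UNIV" for s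
      using l2[of s] by (simp add: l2_def)
    have a_sq: "(\<lambda>n. a n * (cmod (w s n))\<^sup>2) summable_on UNIV" for s
      using weighted_inner_summable[OF l2[of s] l2[of s] a_abs] by (simp add: power2_norm_eq_inner)
    define E where "E s = weighted_inner a (w s) (w s)" for s
    have E: "E s = (\<Sum>\<^sub>\<infinity>n. a n * (cmod (w s n))\<^sup>2)" for s
      by (simp add: E_def weighted_inner_def power2_norm_eq_inner)
    have "(E has_real_derivative 0) (at s)" for s
    proof -
      have "l2_has_derivative w (euler_rhs p k \<Gamma> (w s)) s"
        using sol by (simp add: is_solution_def)
      from weighted_inner_has_derivative[OF this a_abs]
      have "(E has_real_derivative 2 * weighted_inner a (w s) (euler_rhs p k \<Gamma> (w s))) (at s)"
        by (simp add: E_def[abs_def])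
      also have "weighted_inner a (w s) (euler_rhs p k \<Gamma> (w s)) = 0"
        unfolding a_def[abs_def] by (rule weighted_inner_euler_rhs[OF l2 rho_abs])
      finally show ?thesis
        by simp
    qed
    \<comment> \<open>The derivative vanishes on the whole real line, which covers backward as well
      as forward times.\<close>
    then have conserved: "E t = E 0"
      using DERIV_isconst_all by blast
    \<comment> \<open>The energy at time \<open>t\<close> is bounded below by its smallest weight
      and the energy at time 0 above by the supremum \<open>S\<close>; dividing by
      \<open>a m\<close> leaves the ratio.\<close>
    have "a m * (\<Sum>\<^sub>\<infinity>n. (cmod (w t n))\<^sup>2) = (\<Sum>\<^sub>\<infinity>n. a m * (cmod (w t n))\<^sup>2)"
      by (rule infsum_cmult_right'[symmetric])
    also have "\<dots> \<le> E t"
      unfolding E by (intro infsum_mono a_sq summable_on_cmult_right sq mult_right_mono m) simp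
    also have "\<dots> = E 0"
      by (rule conserved)
    also have "\<dots> \<le> (\<Sum>\<^sub>\<infinity>n. S * (cmod (w 0 n))\<^sup>2)"
      unfolding E by (intro infsum_mono a_sq summable_on_cmult_right sq mult_right_mono a_le_S) simp
    also have "\<dots> = S * (\<Sum>\<^sub>\<infinity>n. (cmod (w 0 n))\<^sup>2)"
      by (rule infsum_cmult_right')
    finally show ?thesis
      using a_pos[of m] by (simp add: ratio field_simps)
  qed
  have "liapunov_stable {w. is_solution p k \<Gamma> w}"
    unfolding liapunov_stable_def
  proof (intro allI impI)
    fix \<epsilon> :: real
    assume \<epsilon>: "0 < \<epsilon>"
    \<comment> \<open>The estimate concerns squared norms, so norms grow by at most the square root
      of the ratio, and \<open>\<epsilon> / ?r\<close> serves as \<open>\<delta>\<close>.\<close>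
    let ?r = "sqrt (energy_ratio p k)"
    have "l2_norm (w t) < \<epsilon>" if "is_solution p k \<Gamma> w" "l2_norm (w 0) < \<epsilon> / ?r" for w t
    proof -
      have "l2_norm (w t) \<le> ?r * l2_norm (w 0)"
        using real_sqrt_le_mono[OF estimate[OF that(1)]] by (simp add: l2_norm_def real_sqrt_mult)
      also have "\<dots> < \<epsilon>"
        using that(2) ratio_pos by (simp add: field_simps)
      finally show ?thesis .
    qed
    then show "\<exists>\<delta>>0. \<forall>w\<in>{w. is_solution p k \<Gamma> w}. l2_norm (w 0) < \<delta> \<longrightarrow> (\<forall>t. l2_norm (w t) < \<epsilon>)"
      using \<epsilon> ratio_pos by (intro exI[of _ "\<epsilon> / ?r"]) auto
  qed
  then show ?thesis
    using estimate bdd a_pos m ratio_pos by (auto simp: a_def[abs_def])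
qed

end
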